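(* Let $f=(f_1,\dots,f_m):\mathscr{D}(f)\subseteq\mathbb{R}^n\to\mathbb{R}^m$ be a nonlinear function, let $C=\bigcap_{i=1}^{k_c}C_i$ be a nonempty intersection of finitely many nonempty closed convex sets $C_i\subseteq\mathbb{R}^n$, and let $x_0\in\mathscr{D}(f)$. Assume that (i) $f$ satisfies the local tangential cone condition in the ball $\mathscr{B}_\rho(x_0)$; (ii) for every $x\in\mathscr{D}(f)$ the Jacobian $f'(x)$ is row bounded below and is a full column rank matrix; and that the problem "$f(x)=0$ subject to $x\in C$" is solvable in $\mathscr{B}_{\rho/2}(x_0)$. Then the iteration sequence $\{x_k\}_{k=0}^\infty$ generated by the PSKM method (started at $x_0$) converges in expectation to a solution $x^*\in\mathscr{B}_{\rho/2}(x_0)$ of this problem. Moreover, the mean squared iteration error satisfies, for $k=1,2,\dots$, $$E\|x_k-x^*\|^2\le\left(1-\frac{(1-2\eta)\,\sigma_{\min}^2(f'(x_{k-1}))}{m(1+\eta)^2\|f'(x_{k-1})\|_F^2}\right)E\|x_{k-1}-x^*\|^2,$$ where $\eta=\max_i\eta_i<\frac12$ $(i=1,\dots,m)$ is the constant of the local tangential cone condition.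
   Context: $f$ is differentiable, with Jacobian $f'(x)\in\mathbb{R}^{m\times n}$ whose $i$th row is the gradient $\nabla f_i(x)$ (a row vector). $\|\cdot\|$ is the Euclidean norm, $\|\cdot\|_F$ the Frobenius norm, $\sigma_{\min}(A)$ the smallest nonzero singular value of $A$. $\mathscr{B}_r(x_0)=\{x:\|x-x_0\|\le r\}$. $P_X$ is the metric projection onto a closed convex set $X$. Row bounded below: a matrix $A\in\mathbb{R}^{m\times n}$ is row bounded below if there is $\varepsilon>0$ with $\|A(i,:)\|\ge\varepsilon$ for all $1\le i\le m$, where $A(i,:)$ is the $i$th row. Local tangential cone condition: $f$ satisfies it in the ball $\mathscr{B}_\rho(x_0)\subset\mathscr{D}(f)$ of radius $\rho$ around $x_0$ if for every $i\in\{1,\dots,m\}$ and all $x_1,x_2\in\mathscr{B}_\rho(x_0)$ there exists $\eta_i\in[0,\eta]$, where $\eta=\max_i\eta_i<\frac12$, such that $|f_i(x_1)-f_i(x_2)-\nabla f_i(x_1)(x_1-x_2)|\le\eta_i|f_i(x_1)-f_i(x_2)|$. PSKM method (projected sampling Kaczmarz-Motzkin): fix a sample size $\beta\in\{1,\dots,m\}$ and the initial point $x_0$. For $k=1,2,\dots$: choose a subset $\tau_k\subseteq\{1,\dots,m\}$ of size $\beta$ uniformly at random; let $i_k\in\arg\max_{i\in\tau_k}|f_i(x_{k-1})|$; set $x_{k-\frac12}=x_{k-1}-\frac{f_{i_k}(x_{k-1})}{\|\nabla f_{i_k}(x_{k-1})\|^2}\nabla f_{i_k}(x_{k-1})^T$;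 choose $\alpha_k$ uniformly at random from $\{1,\dots,k_c\}$; set $x_k=P_{C_{\alpha_k}}(x_{k-\frac12})$. $E$ denotes expectation over the random choices of the method; convergence of $x_k$ to $x^*$ in expectation refers to $E\|x_k-x^*\|^2\to0$.
   Formalization: The coefficient depends on the random x_{k-1}, so the displayed bound is read as E conditional on the first k-1 iterations (almost surely, with ‖x_{k-1}-x*‖² on the right), and also in total expectation with the coefficient inside E. *)

theory Defs
  imports "HOL-Probability.Probability"
begin

definition row_bounded_below :: "real^'n^'m \<Rightarrow> bool" where
  "row_bounded_below A \<longleftrightarrow> (\<exists>\<epsilon>>0. \<forall>i. norm (row i A) \<ge> \<epsilon>)"

definition frobenius_norm :: "real^'n^'m \<Rightarrow> real" where
  "frobenius_norm A = sqrt (\<Sum>i\<in>UNIV. \<Sum>j\<in>UNIV. (A $ i $ j)\<^sup>2)"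

definition singular_values :: "real^'n^'m \<Rightarrow> real set" where
  "singular_values A =
     {s. 0 \<le> s \<and> (\<exists>v. v \<noteq> 0 \<and> (transpose A ** A) *v v = s\<^sup>2 *\<^sub>R v)}"

text \<open>The set below is finite, and it is nonempty unless \<open>A = 0\<close>.\<close>

definition sigma_min :: "real^'n^'m \<Rightarrow> real" where
  "sigma_min A = Min (singular_values A - {0})"

text \<open>
  \<open>J x\<close> is the Jacobian of \<open>f\<close> at \<open>x\<close>.  The constant \<open>e\<close> may depend on the component and on the
  two points, subject to the common bound \<open>\<eta>\<close>; componentwise constants with maximum \<open>\<eta>\<close> are the
  special case in which it depends on the component only.
\<close>

definition local_tangential_cone ::
    "(real^'n \<Rightarrow> real^'m) \<Rightarrow> (real^'n \<Rightarrow> real^'n^'m) \<Rightarrow> (real^'n) set \<Rightarrow> real \<Rightarrow> bool" where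
  "local_tangential_cone f J S \<eta> \<longleftrightarrow> \<eta> < 1/2 \<and>
     (\<forall>i. \<forall>x\<^sub>1\<in>S. \<forall>x\<^sub>2\<in>S. \<exists>e\<in>{0..\<eta>}.
        \<bar>f x\<^sub>1 $ i - f x\<^sub>2 $ i - row i (J x\<^sub>1) \<bullet> (x\<^sub>1 - x\<^sub>2)\<bar> \<le> e * \<bar>f x\<^sub>1 $ i - f x\<^sub>2 $ i\<bar>)"

definition kaczmarz_step ::
    "(real^'n \<Rightarrow> real^'m) \<Rightarrow> (real^'n \<Rightarrow> real^'n^'m) \<Rightarrow> 'm \<Rightarrow> real^'n \<Rightarrow> real^'n" where
  "kaczmarz_step f J i x =
     x - (f x $ i / (norm (row i (J x)))\<^sup>2) *\<^sub>R row i (J x)"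

text \<open>
  The iterates as a function of the selected rows \<open>i 1, i 2, \<dots>\<close> and the selected constraint sets
  \<open>a 1, a 2, \<dots>\<close>; the values \<open>i 0\<close> and \<open>a 0\<close> are not used.
\<close>

primrec pskm_iterate ::
    "(real^'n \<Rightarrow> real^'m) \<Rightarrow> (real^'n \<Rightarrow> real^'n^'m) \<Rightarrow> ('c \<Rightarrow> (real^'n) set) \<Rightarrow> real^'n \<Rightarrow>
     (nat \<Rightarrow> 'm) \<Rightarrow> (nat \<Rightarrow> 'c) \<Rightarrow> nat \<Rightarrow> real^'n" where
  "pskm_iterate f J C x\<^sub>0 i a 0 = x\<^sub>0"
| "pskm_iterate f J C x\<^sub>0 i a (Suc k) =
     closest_point (C (a (Suc k))) (kaczmarz_step f J (i (Suc k)) (pskm_iterate f J C x\<^sub>0 i a k))"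

definition pskm_history ::
    "(nat \<Rightarrow> 'w \<Rightarrow> 'm set) \<Rightarrow> (nat \<Rightarrow> 'w \<Rightarrow> 'm) \<Rightarrow> (nat \<Rightarrow> 'w \<Rightarrow> 'c) \<Rightarrow> nat \<Rightarrow> 'w \<Rightarrow>
     ('m set \<times> 'm \<times> 'c) list" where
  "pskm_history \<tau> \<iota> \<alpha> k \<omega> = map (\<lambda>j. (\<tau> j \<omega>, \<iota> j \<omega>, \<alpha> j \<omega>)) [1..<Suc k]"

text \<open>The sigma-algebra generated by all choices made in the first \<open>k\<close> iterations.\<close>

definition pskm_filtration ::
    "'w measure \<Rightarrow> (nat \<Rightarrow> 'w \<Rightarrow> 'm set) \<Rightarrow> (nat \<Rightarrow> 'w \<Rightarrow> 'm) \<Rightarrow> (nat \<Rightarrow> 'w \<Rightarrow> 'c) \<Rightarrow> nat \<Rightarrow>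
     'w measure" where
  "pskm_filtration M \<tau> \<iota> \<alpha> k =
     vimage_algebra (space M) (pskm_history \<tau> \<iota> \<alpha> k) (count_space UNIV)"

text \<open>
  A run of the projected sampling Kaczmarz-Motzkin method on a probability space.  In each iteration
  the sample \<open>\<tau>\<close> is uniform among the index sets of size \<open>\<beta>\<close> and independent of all earlier
  iterations; the row \<open>\<iota>\<close> is any maximiser of the residual over the sample, ties being broken
  arbitrarily (possibly at random, but without knowledge of later choices); the constraint set
  \<open>\<alpha>\<close> is uniform and independent of everything chosen before it.  \<open>indep_set\<close>
  requires its arguments to consist of events, so it also makes the choices measurable.
\<close>

locale pskm = prob_space M
  for M :: "'w measure" +
  fixes f :: "real^'n \<Rightarrow> real^'m"
    and J :: "real^'n \<Rightarrow> real^'n^'m"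
    and C :: "'c::finite \<Rightarrow> (real^'n) set"
    and x\<^sub>0 :: "real^'n"
    and \<beta> :: nat
    and \<tau> :: "nat \<Rightarrow> 'w \<Rightarrow> 'm set"
    and \<iota> :: "nat \<Rightarrow> 'w \<Rightarrow> 'm"
    and \<alpha> :: "nat \<Rightarrow> 'w \<Rightarrow> 'c"
    and X :: "nat \<Rightarrow> 'w \<Rightarrow> real^'n"
  assumes sample_size: "1 \<le> \<beta>" "\<beta> \<le> CARD('m)"
    and sample_uniform: "\<And>k. distr M (count_space UNIV) (\<tau> (Suc k)) =
      measure_pmf (pmf_of_set {T. card T = \<beta>})"
    and sample_indep: "\<And>k. indep_set
      (sets (pskm_filtration M \<tau> \<iota> \<alpha> k))
      (sets (vimage_algebra (space M) (\<tau> (Suc k)) (count_space UNIV)))"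
    and row_greedy: "\<And>k. AE \<omega> in M.
      is_arg_max (\<lambda>j. \<bar>f (X k \<omega>) $ j\<bar>) (\<lambda>j. j \<in> \<tau> (Suc k) \<omega>) (\<iota> (Suc k) \<omega>)"
    and constraint_uniform: "\<And>k. distr M (count_space UNIV) (\<alpha> (Suc k)) =
      measure_pmf (pmf_of_set UNIV)"
    and constraint_indep: "\<And>k. indep_set
      (sets (vimage_algebra (space M)
        (\<lambda>\<omega>. (pskm_history \<tau> \<iota> \<alpha> k \<omega>, \<tau> (Suc k) \<omega>, \<iota> (Suc k) \<omega>)) (count_space UNIV)))
      (sets (vimage_algebra (space M) (\<alpha> (Suc k)) (count_space UNIV)))"
    and iterates: "\<And>k \<omega>. X k \<omega> = pskm_iterate f J C x\<^sub>0 (\<lambda>j. \<iota> j \<omega>) (\<lambda>j. \<alpha> j \<omega>) k"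

definition converges_in_expectation ::
    "'w measure \<Rightarrow> (nat \<Rightarrow> 'w \<Rightarrow> real^'n) \<Rightarrow> real^'n \<Rightarrow> bool" where
  "converges_in_expectation M X x \<longleftrightarrow>
     (\<forall>k. integrable M (\<lambda>\<omega>. (norm (X k \<omega> - x))\<^sup>2)) \<and>
     (\<lambda>k. \<integral>\<omega>. (norm (X k \<omega> - x))\<^sup>2 \<partial>M) \<longlonglongrightarrow> 0"

definition pskm_factor :: "real \<Rightarrow> real^'n^'m \<Rightarrow> real" where
  "pskm_factor \<eta> A =
     1 - (1 - 2 * \<eta>) * (sigma_min A)\<^sup>2 /
         (real CARD('m) * (1 + \<eta>)\<^sup>2 * (frobenius_norm A)\<^sup>2)"

end

theory Submission
  imports Defs
begin

text \<open>
  Let \<open>z\<close> be a solution within \<open>\<rho> / 2\<close> of \<open>x\<^sub>0\<close>.  The cone condition says that at a point \<open>x\<close> of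
  the ball the linearised residual \<open>\<nabla>f\<^sub>i(x) (x - z)\<close> equals \<open>f\<^sub>i(x)\<close> up to a relative error \<open>\<eta> < 1/2\<close>.
  So a Kaczmarz step in row \<open>i\<close> lowers \<open>\<parallel>x - z\<parallel>\<^sup>2\<close> by at least
  \<open>(1 - 2 \<eta>) f\<^sub>i(x)\<^sup>2 / \<parallel>\<nabla>f\<^sub>i(x)\<parallel>\<^sup>2\<close> (\<open>kaczmarz_step_descent\<close>), and the projection onto a convex set
  containing \<open>z\<close> does not increase it again.  In particular, whatever the choices are, the iterates
  stay within \<open>\<rho> / 2\<close> of \<open>z\<close>, hence in the ball, and the estimate can be repeated.

  The greedy row does at least as well as the average row of its sample, and averaging over a
  uniform sample that is independent of the past averages over all \<open>m\<close> rows.  So, conditionally on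
  the past, \<open>\<parallel>x - z\<parallel>\<^sup>2\<close> decreases on average by at least
  \<open>(1 - 2 \<eta>) \<parallel>f(x)\<parallel>\<^sup>2 / (m \<parallel>f'(x)\<parallel>\<^sub>F\<^sup>2)\<close> (\<open>cond_exp_descent\<close>).  It remains to bound \<open>\<parallel>f(x)\<parallel>\<close>
  from below by \<open>\<parallel>x - z\<parallel>\<close>, and the cone condition does this in two ways, since the derivative may be
  taken at either point (\<open>cone_singular_value_bound\<close>).

  With the derivative at \<open>x\<close> one gets the rate of the theorem, with \<open>\<sigma>\<^sub>m\<^sub>i\<^sub>n(f'(x))\<close>.  For
  convergence the rate has to stay away from \<open>1\<close>, and since \<open>f'\<close> is not supposed to be continuous,
  compactness of the ball does not give that directly.  With the derivative at \<open>z\<close>, however, the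
  lower bound involves the fixed number \<open>\<sigma>\<^sub>m\<^sub>i\<^sub>n(f'(z)) > 0\<close>.  As the cone condition also forces
  \<open>f'\<close> to be bounded on the ball (\<open>cone_jacobian_bounded\<close>), the mean squared error contracts by a
  fixed factor below \<open>1\<close> (\<open>uniform_descent\<close>) and tends to \<open>0\<close>.
\<close>

section \<open>The smallest singular value of an injective matrix\<close>

lemma gram_matrix_inner:
  fixes A :: "real^'n^'m"
  shows "((transpose A ** A) *v v) \<bullet> w = (A *v v) \<bullet> (A *v w)"
  by (metis dot_lmul_matrix inner_commute matrix_vector_mul_assoc vector_transpose_matrix transpose_transpose)

text \<open>
  Eigenvectors of the symmetric matrix \<open>A\<^sup>T A\<close> for different eigenvalues are orthogonal, so one
  eigenvector for each singular value gives an independent family.  Finiteness is what makes the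
  minimum in \<open>sigma_min\<close> an element of the set and a lower bound for it.
\<close>

lemma finite_singular_values:
  fixes A :: "real^'n^'m"
  shows "finite (singular_values A)"
proof -
  have "\<forall>s\<in>singular_values A. \<exists>v. v \<noteq> 0 \<and> (transpose A ** A) *v v = s\<^sup>2 *\<^sub>R v"
    by (auto simp: singular_values_def)
  then obtain e where e: "\<And>s. s \<in> singular_values A \<Longrightarrow> e s \<noteq> 0"
      "\<And>s. s \<in> singular_values A \<Longrightarrow> (transpose A ** A) *v e s = s\<^sup>2 *\<^sub>R e s"
    by metis
  have orth: "e s \<bullet> e t = 0" if "s \<in> singular_values A" "t \<in> singular_values A" "s \<noteq> t" for s t
  proof -
    have "s\<^sup>2 * (e s \<bullet> e t) = ((transpose A ** A) *v e s) \<bullet> e t"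
      using e(2)[OF that(1)] by simp
    also have "\<dots> = (A *v e t) \<bullet> (A *v e s)"
      unfolding gram_matrix_inner by (rule inner_commute)
    also have "\<dots> = ((transpose A ** A) *v e t) \<bullet> e s"
      by (rule gram_matrix_inner[symmetric])
    also have "\<dots> = t\<^sup>2 * (e s \<bullet> e t)"
      using e(2)[OF that(2)] by (simp add: inner_commute)
    finally have "(s\<^sup>2 - t\<^sup>2) * (e s \<bullet> e t) = 0"
      by (simp add: left_diff_distrib)
    moreover have "s\<^sup>2 \<noteq> t\<^sup>2"
      using that power2_eq_iff_nonneg[of s t] unfolding singular_values_def by blast
    ultimately show ?thesis by simp
  qed
  have "pairwise orthogonal (e ` singular_values A)"
    using orth by (fastforce simp: pairwise_def orthogonal_def)
  moreover have "0 \<notin> e ` singular_values A"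
  proof
    assume "0 \<in> e ` singular_values A"
    then obtain s where "s \<in> singular_values A" "e s = 0" by auto
    with e(1) show False by blast
  qed
  ultimately have "finite (e ` singular_values A)"
    by (intro independent_imp_finite pairwise_orthogonal_independent)
  moreover have "inj_on e (singular_values A)"
  proof (rule inj_onI, rule ccontr)
    fix s t
    assume st: "s \<in> singular_values A" "t \<in> singular_values A" "e s = e t" "s \<noteq> t"
    then have "e s \<bullet> e s = 0" using orth[OF st(1,2,4)] by simp
    with e(1)[OF st(1)] show False by simp
  qed
  ultimately show ?thesis
    by (simp add: finite_image_iff)
qed

text \<open>
  At a minimiser \<open>v\<close> of \<open>\<parallel>A v\<parallel>\<close> on the unit sphere the quadratic form
  \<open>\<parallel>A w\<parallel>\<^sup>2 - \<lambda> \<parallel>w\<parallel>\<^sup>2\<close> with \<open>\<lambda> = \<parallel>A v\<parallel>\<^sup>2\<close> is nonnegative and vanishes at \<open>v\<close>, so its derivative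
  vanishes there: \<open>v\<close> is an eigenvector of \<open>A\<^sup>T A\<close>, and the minimum is a singular value.
\<close>

lemma min_norm_on_sphere_singular_value:
  fixes A :: "real^'n^'m"
  obtains s where "s \<in> singular_values A" "\<And>x. s * norm x \<le> norm (A *v x)"
    "\<exists>v. norm v = 1 \<and> norm (A *v v) = s"
proof -
  have "axis undefined (1::real) \<in> (sphere 0 1 :: (real^'n) set)"
    by simp
  then have ne: "(sphere 0 1 :: (real^'n) set) \<noteq> {}" by blast
  have "continuous_on (sphere 0 1) (\<lambda>v. norm (A *v v))"
    by (intro continuous_intros)
  from continuous_attains_inf[OF compact_sphere ne this]
  obtain v where v: "norm v = 1" "\<And>w. norm w = 1 \<Longrightarrow> norm (A *v v) \<le> norm (A *v w)"
    by auto
  define s where "s = norm (A *v v)"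
  have bound: "s * norm x \<le> norm (A *v x)" for x
  proof (cases "x = 0")
    case False
    then have "norm ((1 / norm x) *\<^sub>R x) = 1" by simp
    from v(2)[OF this] have "s \<le> norm (A *v x) / norm x"
      by (simp add: s_def matrix_vector_mult_scaleR)
    then show ?thesis
      using False by (simp add: field_simps)
  qed simp
  define r where "r = (transpose A ** A) *v v - s\<^sup>2 *\<^sub>R v"
  define q where "q = (norm (A *v r))\<^sup>2 - s\<^sup>2 * (norm r)\<^sup>2"
  have sq: "s\<^sup>2 * (norm x)\<^sup>2 \<le> (norm (A *v x))\<^sup>2" for x
    using power_mono[OF bound[of x], of 2] by (simp add: s_def power_mult_distrib)
  have pos: "0 \<le> 2 * t * (norm r)\<^sup>2 + t\<^sup>2 * q" for t
  proof -
    have rr: "(A *v v) \<bullet> (A *v r) - s\<^sup>2 * (v \<bullet> r) = (norm r)\<^sup>2"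
      by (simp add: power2_norm_eq_inner gram_matrix_inner[symmetric] r_def inner_diff_left)
    have "0 \<le> (norm (A *v (v + t *\<^sub>R r)))\<^sup>2 - s\<^sup>2 * (norm (v + t *\<^sub>R r))\<^sup>2"
      using sq by simp
    also have "\<dots> = ((norm (A *v v))\<^sup>2 - s\<^sup>2 * (norm v)\<^sup>2)
        + 2 * t * ((A *v v) \<bullet> (A *v r) - s\<^sup>2 * (v \<bullet> r)) + t\<^sup>2 * q"
      unfolding q_def power2_norm_eq_inner
      by (simp add: matrix_vector_right_distrib matrix_vector_mult_scaleR inner_add_left
          inner_add_right inner_commute algebra_simps power2_eq_square)
    also have "(norm (A *v v))\<^sup>2 - s\<^sup>2 * (norm v)\<^sup>2 = 0"
      using v(1) by (simp add: s_def)
    finally show ?thesis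
      using rr by simp
  qed
  have q0: "0 \<le> q" using sq by (simp add: q_def)
  have "r = 0"
  proof (rule ccontr)
    assume "r \<noteq> 0"
    then have b: "0 < (norm r)\<^sup>2" by simp
    define t where "t = - (norm r)\<^sup>2 / (q + 1)"
    have "t < 0" using b q0 by (simp add: t_def)
    have "t * (q + 1) = - (norm r)\<^sup>2" using q0 by (simp add: t_def)
    then have "2 * t * (norm r)\<^sup>2 + t\<^sup>2 * q = t * ((norm r)\<^sup>2 - t)"
      by algebra
    also have "\<dots> < 0"
    proof (rule mult_neg_pos[OF \<open>t < 0\<close>])
      show "0 < (norm r)\<^sup>2 - t" using \<open>t < 0\<close> b by linarith
    qed
    finally show False using pos[of t] by simp
  qed
  moreover have "v \<noteq> 0" using v(1) by auto
  ultimately have "s \<in> singular_values A"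
    by (auto simp: singular_values_def r_def s_def)
  then show thesis
    using that bound v(1) s_def by blast
qed

lemma sigma_min_full_column_rank:
  fixes A :: "real^'n^'m"
  assumes "rank A = CARD('n)"
  shows "0 < sigma_min A" "sigma_min A * norm x \<le> norm (A *v x)"
proof -
  have inj: "inj ((*v) A)"
    using assms full_rank_injective by blast
  obtain s where s: "s \<in> singular_values A" "\<And>x. s * norm x \<le> norm (A *v x)"
    "\<exists>v. norm v = 1 \<and> norm (A *v v) = s"
    using min_norm_on_sphere_singular_value by blast
  have "s \<noteq> 0"
  proof
    assume "s = 0"
    with s(3) obtain v where "norm v = 1" "A *v v = 0" by auto
    moreover have "A *v 0 = 0" by simp
    ultimately have "v = 0" using inj by (metis injD)
    with \<open>norm v = 1\<close> show False by simp
  qed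
  with s(1) have mem: "s \<in> singular_values A - {0}" by simp
  have fin: "finite (singular_values A - {0})"
    by (simp add: finite_singular_values)
  have "Min (singular_values A - {0}) \<in> singular_values A - {0}"
    using mem by (intro Min_in fin) auto
  then show "0 < sigma_min A"
    by (auto simp: sigma_min_def singular_values_def)
  have "sigma_min A \<le> s"
    unfolding sigma_min_def by (rule Min_le[OF fin mem])
  then show "sigma_min A * norm x \<le> norm (A *v x)"
    using s(2)[of x] by (meson mult_right_mono norm_ge_zero order_trans)
qed

section \<open>Consequences of the tangential cone condition\<close>

lemma frobenius_norm_sq: "(frobenius_norm A)\<^sup>2 = (\<Sum>i\<in>UNIV. (norm (row i A))\<^sup>2)"
proof -
  have "(frobenius_norm A)\<^sup>2 = (\<Sum>i\<in>UNIV. \<Sum>j\<in>UNIV. (A $ i $ j)\<^sup>2)"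
    by (simp add: frobenius_norm_def sum_nonneg)
  also have "\<dots> = (\<Sum>i\<in>UNIV. (norm (row i A))\<^sup>2)"
    by (simp add: norm_vec_def L2_set_def row_def sum_nonneg)
  finally show ?thesis .
qed

lemma row_norm_le_frobenius: "(norm (row i A))\<^sup>2 \<le> (frobenius_norm A)\<^sup>2"
  unfolding frobenius_norm_sq by (rule member_le_sum) auto

lemma row_bounded_below_row_nonzero: "row_bounded_below A \<Longrightarrow> row i A \<noteq> 0"
  unfolding row_bounded_below_def by (metis norm_zero not_less)

lemma row_bounded_below_frobenius_pos:
  fixes A :: "real^'n^'m"
  assumes "row_bounded_below A"
  shows "0 < (frobenius_norm A)\<^sup>2"
proof -
  have "0 < (norm (row undefined A))\<^sup>2"
    using row_bounded_below_row_nonzero[OF assms] by simp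
  with row_norm_le_frobenius[of undefined A] show ?thesis by linarith
qed

lemma cone_constant_bounds:
  assumes "local_tangential_cone f J S \<eta>" "x \<in> S"
  shows "0 \<le> \<eta>" "\<eta> < 1/2"
proof -
  show "\<eta> < 1/2" using assms(1) by (simp add: local_tangential_cone_def)
  from assms obtain e where "e \<in> {0..\<eta>}"
    unfolding local_tangential_cone_def by blast
  then show "0 \<le> \<eta>" by simp
qed

lemma cone_remainder_bound:
  assumes "local_tangential_cone f J S \<eta>" "x \<in> S" "y \<in> S"
  shows "\<bar>f x $ i - f y $ i - row i (J x) \<bullet> (x - y)\<bar> \<le> \<eta> * \<bar>f x $ i - f y $ i\<bar>"
proof -
  from assms obtain e where e: "e \<le> \<eta>"
      "\<bar>f x $ i - f y $ i - row i (J x) \<bullet> (x - y)\<bar> \<le> e * \<bar>f x $ i - f y $ i\<bar>"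
    unfolding local_tangential_cone_def by (metis atLeastAtMost_iff)
  have "e * \<bar>f x $ i - f y $ i\<bar> \<le> \<eta> * \<bar>f x $ i - f y $ i\<bar>"
    by (rule mult_right_mono) (use e(1) in auto)
  with e(2) show ?thesis by linarith
qed

lemma cone_linearisation_le:
  assumes "local_tangential_cone f J S \<eta>" "x \<in> S" "y \<in> S"
  shows "\<bar>row i (J x) \<bullet> (x - y)\<bar> \<le> (1 + \<eta>) * \<bar>f x $ i - f y $ i\<bar>"
  using cone_remainder_bound[OF assms, of i] by (simp add: algebra_simps)

text \<open>
  The Jacobian may be taken at either of the two points: taken at \<open>x\<close> it gives the stated rate,
  taken at a solution it gives a bound whose constant is the same for all \<open>y\<close>.
\<close>

lemma cone_singular_value_bound:
  fixes f :: "real^'n \<Rightarrow> real^'m"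
  assumes cone: "local_tangential_cone f J S \<eta>" and xy: "x \<in> S" "y \<in> S"
    and rank: "rank (J x) = CARD('n)"
  shows "(sigma_min (J x))\<^sup>2 * (norm (x - y))\<^sup>2 \<le> (1 + \<eta>)\<^sup>2 * (norm (f x - f y))\<^sup>2"
proof -
  have "(sigma_min (J x) * norm (x - y))\<^sup>2 \<le> (norm (J x *v (x - y)))\<^sup>2"
    using sigma_min_full_column_rank[OF rank] by (intro power_mono) (auto simp: less_imp_le)
  also have "\<dots> = (\<Sum>i\<in>UNIV. (row i (J x) \<bullet> (x - y))\<^sup>2)"
    by (simp add: norm_vec_def L2_set_def sum_nonneg matrix_vector_mul_component row_def)
  also have "\<dots> \<le> (\<Sum>i\<in>UNIV. (1 + \<eta>)\<^sup>2 * ((f x - f y) $ i)\<^sup>2)"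
  proof (rule sum_mono)
    fix i
    have "\<bar>row i (J x) \<bullet> (x - y)\<bar>\<^sup>2 \<le> ((1 + \<eta>) * \<bar>f x $ i - f y $ i\<bar>)\<^sup>2"
      by (rule power_mono[OF cone_linearisation_le[OF cone xy]]) simp
    then show "(row i (J x) \<bullet> (x - y))\<^sup>2 \<le> (1 + \<eta>)\<^sup>2 * ((f x - f y) $ i)\<^sup>2"
      by (simp add: power_mult_distrib)
  qed
  also have "\<dots> = (1 + \<eta>)\<^sup>2 * (norm (f x - f y))\<^sup>2"
    by (simp add: norm_vec_def L2_set_def sum_nonneg sum_distrib_left)
  finally show ?thesis
    by (simp add: power_mult_distrib)
qed

text \<open>
  Although \<open>J\<close> need not be continuous, it is bounded on the ball: by the cone condition the
  linearisation at \<open>x\<close> is bounded on all of the ball by the oscillation of \<open>f\<close>, and a linear form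
  that is bounded on a ball of radius \<open>\<rho>\<close> has bounded norm.
\<close>

lemma cone_jacobian_bounded:
  fixes f :: "real^'n \<Rightarrow> real^'m"
  assumes cone: "local_tangential_cone f J (cball z \<rho>) \<eta>" and \<rho>: "0 < \<rho>"
    and cont: "continuous_on (cball z \<rho>) f"
  obtains B where "0 < B" "\<And>x. x \<in> cball z \<rho> \<Longrightarrow> (frobenius_norm (J x))\<^sup>2 \<le> B"
proof -
  have "bounded (f ` cball z \<rho>)"
    using cont by (intro compact_imp_bounded compact_continuous_image) auto
  then obtain K where K: "0 < K" "\<And>x. x \<in> cball z \<rho> \<Longrightarrow> norm (f x) \<le> K"
    unfolding bounded_pos by blast
  have z: "z \<in> cball z \<rho>" using \<rho> by simp
  note eta = cone_constant_bounds[OF cone z]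
  have lin: "\<bar>row i (J x) \<bullet> (x - y)\<bar> \<le> 3 * K" if "x \<in> cball z \<rho>" "y \<in> cball z \<rho>" for i x y
  proof -
    have "\<bar>f x $ i - f y $ i\<bar> \<le> 2 * K"
      using component_le_norm_cart[of "f x" i] component_le_norm_cart[of "f y" i]
        K(2)[OF that(1)] K(2)[OF that(2)] by linarith
    then have "(1 + \<eta>) * \<bar>f x $ i - f y $ i\<bar> \<le> (3/2) * (2 * K)"
      using eta by (intro mult_mono) auto
    with cone_linearisation_le[OF cone that, of i] show ?thesis by simp
  qed
  have row: "norm (row i (J x)) \<le> 6 * K / \<rho>" if x: "x \<in> cball z \<rho>" for i x
  proof -
    let ?g = "row i (J x)"
    \<comment> \<open>If the row vanishes, then \<open>sgn\<close> is zero and \<open>y\<close> is the centre.\<close>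
    let ?y = "z + \<rho> *\<^sub>R sgn ?g"
    have y: "?y \<in> cball z \<rho>"
      using \<rho> by (simp add: dist_norm norm_sgn)
    have "\<rho> * norm ?g = ?g \<bullet> (x - z) - ?g \<bullet> (x - ?y)"
      by (cases "?g = 0") (simp_all add: inner_diff_right inner_add_right sgn_div_norm
          dot_square_norm power2_eq_square)
    also have "\<dots> \<le> 6 * K"
      using lin[OF x z, of i] lin[OF x y, of i] by linarith
    finally show ?thesis
      using \<rho> by (simp add: field_simps)
  qed
  show thesis
  proof (rule that)
    show "0 < real CARD('m) * (6 * K / \<rho>)\<^sup>2"
      using K(1) \<rho> by simp
    fix x assume "x \<in> cball z \<rho>"
    then have "(\<Sum>i\<in>UNIV. (norm (row i (J x)))\<^sup>2) \<le> (\<Sum>i\<in>(UNIV::'m set). (6 * K / \<rho>)\<^sup>2)"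
      by (intro sum_mono power_mono row) auto
    then show "(frobenius_norm (J x))\<^sup>2 \<le> real CARD('m) * (6 * K / \<rho>)\<^sup>2"
      by (simp add: frobenius_norm_sq)
  qed
qed

section \<open>One step of the method\<close>

text \<open>
  Write \<open>r\<close> for the residual \<open>f\<^sub>i(x)\<close> and \<open>g\<close> for the row.  Since \<open>g \<bullet> (x - z)\<close> agrees with \<open>r\<close> up to
  \<open>\<eta> \<bar>r\<bar>\<close>, the mixed term of the expanded square is at most \<open>- 2 (1 - \<eta>) r\<^sup>2 / \<parallel>g\<parallel>\<^sup>2\<close>, which
  outweighs the quadratic term \<open>r\<^sup>2 / \<parallel>g\<parallel>\<^sup>2\<close>.
\<close>

lemma kaczmarz_step_descent:
  assumes cone: "\<bar>f x $ i - row i (J x) \<bullet> (x - z)\<bar> \<le> \<eta> * \<bar>f x $ i\<bar>"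
    and nz: "row i (J x) \<noteq> 0"
  shows "(norm (kaczmarz_step f J i x - z))\<^sup>2
    \<le> (norm (x - z))\<^sup>2 - (1 - 2 * \<eta>) * (f x $ i)\<^sup>2 / (norm (row i (J x)))\<^sup>2"
proof -
  define r where "r = f x $ i"
  define g where "g = row i (J x)"
  define p where "p = g \<bullet> (x - z)"
  have g: "0 < (norm g)\<^sup>2" using nz by (simp add: g_def)
  have "r * (r - p) \<le> \<bar>r\<bar> * \<bar>r - p\<bar>"
    by (metis abs_ge_self abs_mult)
  also have "\<dots> \<le> \<bar>r\<bar> * (\<eta> * \<bar>r\<bar>)"
    using cone by (intro mult_left_mono) (auto simp: r_def g_def p_def)
  also have "\<dots> = \<eta> * r\<^sup>2"
    by (simp add: power2_eq_square)
  finally have rp: "(1 - \<eta>) * r\<^sup>2 \<le> r * p"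
    by (simp add: algebra_simps power2_eq_square)
  have expand: "(norm (u - c *\<^sub>R g))\<^sup>2 = (norm u)\<^sup>2 - 2 * (c * (g \<bullet> u)) + c\<^sup>2 * (norm g)\<^sup>2" for u c
    unfolding power2_norm_eq_inner
    by (simp add: inner_diff_left inner_diff_right inner_commute power2_eq_square)
  have "kaczmarz_step f J i x - z = (x - z) - (r / (norm g)\<^sup>2) *\<^sub>R g"
    by (simp add: kaczmarz_step_def r_def g_def)
  then have "(norm (kaczmarz_step f J i x - z))\<^sup>2
      = (norm (x - z))\<^sup>2 - 2 * ((r / (norm g)\<^sup>2) * p) + (r / (norm g)\<^sup>2)\<^sup>2 * (norm g)\<^sup>2"
    by (simp only: expand p_def)
  also have "\<dots> = (norm (x - z))\<^sup>2 - (2 * (r * p) - r\<^sup>2) / (norm g)\<^sup>2"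
    using g by (simp add: field_simps power2_eq_square)
  also have "\<dots> \<le> (norm (x - z))\<^sup>2 - (1 - 2 * \<eta>) * r\<^sup>2 / (norm g)\<^sup>2"
  proof -
    have "(1 - 2 * \<eta>) * r\<^sup>2 \<le> 2 * (r * p) - r\<^sup>2"
      using rp by (simp add: algebra_simps)
    then show ?thesis
      using g by (simp add: divide_right_mono)
  qed
  finally show ?thesis
    by (simp add: r_def g_def)
qed

lemma closest_point_norm_le:
  fixes C :: "'a::euclidean_space set"
  assumes "closed C" "convex C" "z \<in> C"
  shows "norm (closest_point C y - z) \<le> norm (y - z)"
  using closest_point_lipschitz[OF assms(2,1), of y z] closest_point_self[OF assms(3)] assms(3)
  by (auto simp: dist_norm)

text \<open>
  The largest residual over the sample is at least the average over the sample.  The average is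
  written as a sum over all rows with indicator weights: it is linear in the indicators, so its
  conditional expectation needs only the probabilities that a given row is sampled.
\<close>

lemma greedy_residual_ge_average:
  fixes r :: "'m::finite \<Rightarrow> real"
  assumes max: "is_arg_max (\<lambda>j. \<bar>r j\<bar>) (\<lambda>j. j \<in> T) i" and card: "card T = \<beta>"
  shows "(\<Sum>j\<in>UNIV. (r j)\<^sup>2 * indicator T j) / real \<beta> \<le> (r i)\<^sup>2"
proof -
  have i: "i \<in> T" "\<And>j. j \<in> T \<Longrightarrow> \<bar>r j\<bar> \<le> \<bar>r i\<bar>"
    using max by (force simp: is_arg_max_def)+
  have "\<beta> \<noteq> 0" using i(1) card by (metis card_eq_0_iff empty_iff finite)
  have "(\<Sum>j\<in>UNIV. (r j)\<^sup>2 * indicator T j) = (\<Sum>j\<in>T. (r j)\<^sup>2)"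
    by (simp add: sum.If_cases indicator_def of_bool_def if_distrib cong: if_cong)
  also have "\<dots> \<le> (\<Sum>j\<in>T. (r i)\<^sup>2)"
    using i(2) by (intro sum_mono) (simp add: abs_le_square_iff)
  also have "\<dots> = real \<beta> * (r i)\<^sup>2"
    by (simp add: card)
  finally show ?thesis
    using \<open>\<beta> \<noteq> 0\<close> by (simp add: field_simps)
qed

section \<open>Sampling\<close>

lemma prob_uniform_subset_mem:
  fixes i :: "'m::finite"
  assumes "1 \<le> \<beta>" "\<beta> \<le> CARD('m)"
  shows "measure (measure_pmf (pmf_of_set {T :: 'm set. card T = \<beta>})) {T. i \<in> T}
    = real \<beta> / real CARD('m)"
proof -
  let ?m = "CARD('m)"
  have subsets: "card {T. T \<subseteq> A \<and> card T = k} = card A choose k" for A :: "'m set" and k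
    by (simp add: n_subsets)
  have all: "card {T :: 'm set. card T = \<beta>} = ?m choose \<beta>"
    using subsets[of UNIV \<beta>] by simp
  then have "card {T :: 'm set. card T = \<beta>} \<noteq> 0"
    using assms(2) by simp
  then have ne: "{T :: 'm set. card T = \<beta>} \<noteq> {}"
    by force
  have bij: "bij_betw (insert i) {T. T \<subseteq> UNIV - {i} \<and> card T = \<beta> - 1} {T. card T = \<beta> \<and> i \<in> T}"
  proof (rule bij_betw_byWitness[where f' = "\<lambda>T. T - {i}"])
    show "insert i ` {T. T \<subseteq> UNIV - {i} \<and> card T = \<beta> - 1} \<subseteq> {T. card T = \<beta> \<and> i \<in> T}"
    proof (rule image_subsetI)
      fix T assume "T \<in> {T. T \<subseteq> UNIV - {i} \<and> card T = \<beta> - 1}"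
      then have "i \<notin> T" "card T = \<beta> - 1" by blast+
      then show "insert i T \<in> {T. card T = \<beta> \<and> i \<in> T}"
        using assms(1) by simp
    qed
  qed (auto simp: insert_absorb)
  have "card (UNIV - {i}) = ?m - 1"
    by (simp add: card_Diff_singleton)
  then have "card {T. card T = \<beta> \<and> i \<in> T} = (?m - 1) choose (\<beta> - 1)"
    using subsets[of "UNIV - {i}" "\<beta> - 1"] bij_betw_same_card[OF bij] by simp
  moreover have "{T :: 'm set. card T = \<beta>} \<inter> {T. i \<in> T} = {T. card T = \<beta> \<and> i \<in> T}"
    by auto
  ultimately have "measure (measure_pmf (pmf_of_set {T :: 'm set. card T = \<beta>})) {T. i \<in> T}
      = real ((?m - 1) choose (\<beta> - 1)) / real (?m choose \<beta>)"
    using measure_pmf_of_set[OF ne, of "{T. i \<in> T}"] all by simp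
  moreover have "real \<beta> * real (?m choose \<beta>) = real ?m * real ((?m - 1) choose (\<beta> - 1))"
    unfolding of_nat_mult[symmetric] using times_binomial_minus1_eq[of \<beta> ?m] assms(1) by simp
  moreover have "real (?m choose \<beta>) \<noteq> 0" "real ?m \<noteq> 0" using assms(2) by simp_all
  ultimately show ?thesis
    by (metis frac_eq_eq mult.commute)
qed

context pskm
begin

lemma iterate_Suc:
  "X (Suc k) \<omega> = closest_point (C (\<alpha> (Suc k) \<omega>)) (kaczmarz_step f J (\<iota> (Suc k) \<omega>) (X k \<omega>))"
  by (simp add: iterates)

lemma history_event:
  "A \<in> sets (pskm_filtration M \<tau> \<iota> \<alpha> k) \<Longrightarrow> A \<in> events"
  using indep_setD_ev1[OF sample_indep[of k]] by blast

lemma subalgebra_filtration: "subalgebra M (pskm_filtration M \<tau> \<iota> \<alpha> k)"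
  using history_event by (auto simp: subalgebra_def pskm_filtration_def)

sublocale filtration: finite_measure_subalgebra M "pskm_filtration M \<tau> \<iota> \<alpha> k" for k
  by unfold_locales (rule subalgebra_filtration)

lemma measurable_history:
  "pskm_history \<tau> \<iota> \<alpha> k \<in> measurable (pskm_filtration M \<tau> \<iota> \<alpha> k) (count_space UNIV)"
  unfolding pskm_filtration_def by (rule measurable_vimage_algebra1) simp

lemma finite_histories: "finite (range (pskm_history \<tau> \<iota> \<alpha> k))"
proof (rule finite_subset)
  show "range (pskm_history \<tau> \<iota> \<alpha> k)
      \<subseteq> {xs. set xs \<subseteq> (UNIV :: ('m set \<times> 'm \<times> 'c) set) \<and> length xs = k}"
    by (auto simp: pskm_history_def)
qed (rule finite_lists_length_eq, simp)

text \<open>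
  The iterate \<open>X k\<close> is a function of the choices made up to step \<open>k\<close>, and these take finitely many
  values; therefore every function of \<open>X k\<close> is measurable and integrable, whatever \<open>f\<close> and \<open>J\<close>.
\<close>

lemma iterate_function_of_history:
  obtains F where "\<And>\<omega>. X k \<omega> = F (pskm_history \<tau> \<iota> \<alpha> k \<omega>)"
proof -
  have upt: "[1..<Suc k] ! (j - 1) = j" if "1 \<le> j" "j \<le> k" for j
    using that nth_upt[of 1 "j - 1" "Suc k"] by linarith
  have nth: "pskm_history \<tau> \<iota> \<alpha> k \<omega> ! (j - 1) = (\<tau> j \<omega>, \<iota> j \<omega>, \<alpha> j \<omega>)" if "1 \<le> j" "j \<le> k" for j \<omega>
    using that upt[OF that] by (simp add: pskm_history_def del: upt_Suc)
  \<comment> \<open>A history starts with the choices of step 1, which therefore sit at position 0.\<close>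
  let ?i = "\<lambda>h j. fst (snd (h ! (j - 1)))" and ?a = "\<lambda>h j. snd (snd (h ! (j - 1)))"
  have cong: "pskm_iterate f J C x\<^sub>0 i a n = pskm_iterate f J C x\<^sub>0 i' a' n"
    if "\<And>j. 1 \<le> j \<Longrightarrow> j \<le> n \<Longrightarrow> i j = i' j \<and> a j = a' j" for i i' :: "nat \<Rightarrow> 'm" and a a' n
    using that by (induction n) auto
  have "X k \<omega> = pskm_iterate f J C x\<^sub>0 (?i (pskm_history \<tau> \<iota> \<alpha> k \<omega>)) (?a (pskm_history \<tau> \<iota> \<alpha> k \<omega>)) k" for \<omega>
    unfolding iterates
  proof (rule cong)
    fix j assume "1 \<le> j" "j \<le> k"
    note nth = nth[OF this, of \<omega>]
    show "\<iota> j \<omega> = ?i (pskm_history \<tau> \<iota> \<alpha> k \<omega>) j \<and> \<alpha> j \<omega> = ?a (pskm_history \<tau> \<iota> \<alpha> k \<omega>) j"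
      unfolding nth by simp
  qed
  then show thesis by (rule that[of "\<lambda>h. pskm_iterate f J C x\<^sub>0 (?i h) (?a h) k"])
qed

lemma measurable_iterate:
  "(\<lambda>\<omega>. g (X k \<omega>) :: real) \<in> borel_measurable (pskm_filtration M \<tau> \<iota> \<alpha> k)"
proof -
  obtain F where F: "\<And>\<omega>. X k \<omega> = F (pskm_history \<tau> \<iota> \<alpha> k \<omega>)"
    using iterate_function_of_history by blast
  have "(\<lambda>h. g (F h)) \<in> borel_measurable (count_space UNIV)" by simp
  from measurable_compose[OF measurable_history this] show ?thesis
    by (simp add: F)
qed

lemma integrable_iterate: "integrable M (\<lambda>\<omega>. g (X k \<omega>) :: real)"
proof -
  obtain F where F: "\<And>\<omega>. X k \<omega> = F (pskm_history \<tau> \<iota> \<alpha> k \<omega>)"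
    using iterate_function_of_history by blast
  have "finite ((\<lambda>h. norm (g (F h))) ` range (pskm_history \<tau> \<iota> \<alpha> k))"
    using finite_histories by simp
  then have bound: "norm (g (X k \<omega>)) \<le> Max ((\<lambda>h. norm (g (F h))) ` range (pskm_history \<tau> \<iota> \<alpha> k))" for \<omega>
    by (rule Max_ge) (simp add: F)
  show ?thesis
    by (rule integrable_const_bound[OF AE_I2[OF bound]])
      (rule measurable_from_subalg[OF subalgebra_filtration measurable_iterate])
qed

lemma measurable_sample: "\<tau> (Suc k) \<in> measurable M (count_space UNIV)"
proof (rule measurableI)
  fix A :: "'m set set"
  have "\<tau> (Suc k) -` A \<inter> space M \<in> sets (vimage_algebra (space M) (\<tau> (Suc k)) (count_space UNIV))"
    by (rule in_vimage_algebra) simp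
  then show "\<tau> (Suc k) -` A \<inter> space M \<in> events"
    using indep_setD_ev2[OF sample_indep[of k]] by blast
qed simp

lemma AE_sample_card: "AE \<omega> in M. card (\<tau> (Suc k) \<omega>) = \<beta>"
proof -
  have "card {T :: 'm set. card T = \<beta>} = CARD('m) choose \<beta>"
    using n_subsets[of "UNIV :: 'm set" \<beta>] by simp
  then have "{T :: 'm set. card T = \<beta>} \<noteq> {}"
    using sample_size(2) by (metis card.empty binomial_eq_0_iff not_le)
  then have "AE T in measure_pmf (pmf_of_set {T :: 'm set. card T = \<beta>}). card T = \<beta>"
    by (simp add: AE_measure_pmf_iff)
  then have "AE T in distr M (count_space UNIV) (\<tau> (Suc k)). card T = \<beta>"
    unfolding sample_uniform .
  then show ?thesis
    by (subst (asm) AE_distr_iff[OF measurable_sample]) auto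
qed

text \<open>The sample is independent of the past, so conditioning on the past changes nothing.\<close>

lemma cond_exp_sampled:
  "AE \<omega> in M. real_cond_exp M (pskm_filtration M \<tau> \<iota> \<alpha> k) (\<lambda>\<omega>. indicator (\<tau> (Suc k) \<omega>) i) \<omega>
    = real \<beta> / real CARD('m)"
proof -
  let ?S = "\<tau> (Suc k) -` {T. i \<in> T} \<inter> space M"
  have S_vim: "?S \<in> sets (vimage_algebra (space M) (\<tau> (Suc k)) (count_space UNIV))"
    by (rule in_vimage_algebra) simp
  have S: "?S \<in> events"
    by (rule measurable_sets[OF measurable_sample]) simp
  have prob: "prob ?S = real \<beta> / real CARD('m)"
  proof -
    have "prob ?S = measure (distr M (count_space UNIV) (\<tau> (Suc k))) {T. i \<in> T}"
      by (simp add: measure_distr measurable_sample)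
    then show ?thesis
      by (simp add: sample_uniform prob_uniform_subset_mem[OF sample_size])
  qed
  have ind: "indicator (\<tau> (Suc k) \<omega>) i = (indicator ?S \<omega> :: real)" if "\<omega> \<in> space M" for \<omega>
    using that by (simp add: indicator_def)
  have int: "integrable M (\<lambda>\<omega>. indicator (\<tau> (Suc k) \<omega>) i :: real)"
    using S by (subst Bochner_Integration.integrable_cong[OF refl ind]) (auto simp: less_top[symmetric])
  show ?thesis
  proof (rule filtration.real_cond_exp_charact)
    fix A assume A: "A \<in> sets (pskm_filtration M \<tau> \<iota> \<alpha> k)"
    have "(\<integral>\<omega>\<in>A. indicator (\<tau> (Suc k) \<omega>) i \<partial>M) = (\<integral>\<omega>. indicator (A \<inter> ?S) \<omega> \<partial>M)"
      unfolding set_lebesgue_integral_def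
      by (rule Bochner_Integration.integral_cong) (auto simp: indicator_def)
    also have "\<dots> = prob (A \<inter> ?S)"
      using history_event[OF A] S by (simp add: sets.sets_into_space Int_absorb2)
    also have "\<dots> = prob A * prob ?S"
      by (rule indep_setD[OF sample_indep A S_vim])
    also have "\<dots> = prob A * (real \<beta> / real CARD('m))"
      unfolding prob ..
    also have "\<dots> = (\<integral>\<omega>\<in>A. real \<beta> / real CARD('m) \<partial>M)"
      using history_event[OF A] by (simp add: set_lebesgue_integral_def
          sets.sets_into_space Int_absorb2)
    finally show "(\<integral>\<omega>\<in>A. indicator (\<tau> (Suc k) \<omega>) i \<partial>M) = (\<integral>\<omega>\<in>A. real \<beta> / real CARD('m) \<partial>M)" .
  qed (use int in auto)
qed

lemma integrable_sampled: "integrable M (\<lambda>\<omega>. g (X k \<omega>) * indicator (\<tau> (Suc k) \<omega>) i :: real)"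
proof (rule Bochner_Integration.integrable_bound[OF integrable_iterate[of g k]])
  have "(\<lambda>T. indicator T i :: real) \<in> borel_measurable (count_space UNIV)" by simp
  from measurable_compose[OF measurable_sample this]
  show "(\<lambda>\<omega>. g (X k \<omega>) * indicator (\<tau> (Suc k) \<omega>) i) \<in> borel_measurable M"
    using borel_measurable_integrable[OF integrable_iterate[of g k]] by simp
qed (auto simp: indicator_def)

lemma cond_exp_sampled_sum:
  "AE \<omega> in M. real_cond_exp M (pskm_filtration M \<tau> \<iota> \<alpha> k)
      (\<lambda>\<omega>. \<Sum>i\<in>UNIV. h i (X k \<omega>) * indicator (\<tau> (Suc k) \<omega>) i) \<omega>
    = real \<beta> / real CARD('m) * (\<Sum>i\<in>UNIV. h i (X k \<omega>))"
proof -
  let ?E = "real_cond_exp M (pskm_filtration M \<tau> \<iota> \<alpha> k)"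
  have ind: "(\<lambda>\<omega>. indicator (\<tau> (Suc k) \<omega>) i :: real) \<in> borel_measurable M" for i
    by (rule measurable_compose[OF measurable_sample]) simp
  have mult: "AE \<omega> in M. ?E (\<lambda>\<omega>. h i (X k \<omega>) * indicator (\<tau> (Suc k) \<omega>) i) \<omega>
      = h i (X k \<omega>) * ?E (\<lambda>\<omega>. indicator (\<tau> (Suc k) \<omega>) i) \<omega>" for i
    by (rule filtration.real_cond_exp_mult[OF measurable_iterate ind integrable_sampled])
  have "AE \<omega> in M. ?E (\<lambda>\<omega>. h i (X k \<omega>) * indicator (\<tau> (Suc k) \<omega>) i) \<omega>
      = h i (X k \<omega>) * (real \<beta> / real CARD('m))" for i
    using mult[of i] cond_exp_sampled[of k i] by eventually_elim simp
  then have "AE \<omega> in M. \<forall>i\<in>UNIV. ?E (\<lambda>\<omega>. h i (X k \<omega>) * indicator (\<tau> (Suc k) \<omega>) i) \<omega>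
      = h i (X k \<omega>) * (real \<beta> / real CARD('m))"
    by (rule AE_finite_allI[OF finite])
  moreover have "AE \<omega> in M. ?E (\<lambda>\<omega>. \<Sum>i\<in>UNIV. h i (X k \<omega>) * indicator (\<tau> (Suc k) \<omega>) i) \<omega>
      = (\<Sum>i\<in>UNIV. ?E (\<lambda>\<omega>. h i (X k \<omega>) * indicator (\<tau> (Suc k) \<omega>) i) \<omega>)"
    by (rule filtration.real_cond_exp_sum[OF integrable_sampled])
  ultimately show ?thesis
    by eventually_elim (simp add: sum_distrib_left mult.commute)
qed

end

section \<open>Descent in conditional expectation\<close>

locale pskm_solution = pskm M f J C x\<^sub>0 \<beta> \<tau> \<iota> \<alpha> X
  for M :: "'w measure"
    and f :: "real^'n \<Rightarrow> real^'m"
    and J :: "real^'n \<Rightarrow> real^'n^'m"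
    and C :: "'c::finite \<Rightarrow> (real^'n) set"
    and x\<^sub>0 :: "real^'n"
    and \<beta> :: nat
    and \<tau> :: "nat \<Rightarrow> 'w \<Rightarrow> 'm set"
    and \<iota> :: "nat \<Rightarrow> 'w \<Rightarrow> 'm"
    and \<alpha> :: "nat \<Rightarrow> 'w \<Rightarrow> 'c"
    and X :: "nat \<Rightarrow> 'w \<Rightarrow> real^'n" +
  fixes \<rho> \<eta> :: real and xs :: "real^'n"
  assumes closed: "\<And>c. closed (C c)" and convex: "\<And>c. convex (C c)"
    and radius: "0 < \<rho>"
    and cone: "local_tangential_cone f J (cball x\<^sub>0 \<rho>) \<eta>"
    and rows: "\<And>x. x \<in> cball x\<^sub>0 \<rho> \<Longrightarrow> row_bounded_below (J x)"
    and full_rank: "\<And>x. x \<in> cball x\<^sub>0 \<rho> \<Longrightarrow> rank (J x) = CARD('n)"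
    and solution: "xs \<in> cball x\<^sub>0 (\<rho> / 2)" "f xs = 0" "\<And>c. xs \<in> C c"
begin

lemma eta_bounds: "0 \<le> \<eta>" "\<eta> < 1/2"
  using cone_constant_bounds[OF cone, of x\<^sub>0] radius by auto

lemma solution_in_ball: "xs \<in> cball x\<^sub>0 \<rho>"
  using solution(1) radius by simp

lemma in_ball_if_close: "norm (x - xs) \<le> \<rho> / 2 \<Longrightarrow> x \<in> cball x\<^sub>0 \<rho>"
  using solution(1) dist_triangle[of x\<^sub>0 x xs] by (simp add: dist_norm norm_minus_commute)

lemma step_descent:
  assumes "x \<in> cball x\<^sub>0 \<rho>"
  shows "(norm (closest_point (C c) (kaczmarz_step f J i x) - xs))\<^sup>2
    \<le> (norm (x - xs))\<^sup>2 - (1 - 2 * \<eta>) * (f x $ i)\<^sup>2 / (norm (row i (J x)))\<^sup>2"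
proof -
  have "(norm (closest_point (C c) (kaczmarz_step f J i x) - xs))\<^sup>2
      \<le> (norm (kaczmarz_step f J i x - xs))\<^sup>2"
    by (intro power_mono closest_point_norm_le closed convex solution) simp
  also have "\<dots> \<le> (norm (x - xs))\<^sup>2 - (1 - 2 * \<eta>) * (f x $ i)\<^sup>2 / (norm (row i (J x)))\<^sup>2"
    using cone_remainder_bound[OF cone assms solution_in_ball, of i] solution(2)
    by (intro kaczmarz_step_descent row_bounded_below_row_nonzero rows assms) simp
  finally show ?thesis .
qed

text \<open>
  The cone condition is available at every iterate: the distance to the solution never increases,
  whichever row and set are chosen, and it starts at most \<open>\<rho> / 2\<close>.
\<close>

lemma iterate_in_ball: "X k \<omega> \<in> cball x\<^sub>0 \<rho>"
proof -
  have "norm (X k \<omega> - xs) \<le> \<rho> / 2"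
  proof (induction k)
    case 0
    then show ?case
      using solution(1) by (simp add: iterates dist_norm)
  next
    case (Suc k)
    have "0 \<le> (1 - 2 * \<eta>) * (f (X k \<omega>) $ \<iota> (Suc k) \<omega>)\<^sup>2 / (norm (row (\<iota> (Suc k) \<omega>) (J (X k \<omega>))))\<^sup>2"
      using eta_bounds by simp
    with step_descent[OF in_ball_if_close[OF Suc], of "\<alpha> (Suc k) \<omega>" "\<iota> (Suc k) \<omega>"]
    have "(norm (X (Suc k) \<omega> - xs))\<^sup>2 \<le> (norm (X k \<omega> - xs))\<^sup>2"
      unfolding iterate_Suc by linarith
    then have "norm (X (Suc k) \<omega> - xs) \<le> norm (X k \<omega> - xs)"
      by (rule power2_le_imp_le) simp
    with Suc show ?case by simp
  qed
  then show ?thesis by (rule in_ball_if_close)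
qed

text \<open>
  A given row is sampled with probability \<open>\<beta> / m\<close>, so the average of the squared residuals over
  the sample has conditional expectation \<open>\<parallel>f\<parallel>\<^sup>2 / m\<close>, for every \<open>\<beta>\<close>.  The norm of the selected
  row, which depends on the sample, is replaced by the Frobenius norm, which does not.
\<close>

lemma cond_exp_descent:
  "AE \<omega> in M. real_cond_exp M (pskm_filtration M \<tau> \<iota> \<alpha> k) (\<lambda>\<omega>. (norm (X (Suc k) \<omega> - xs))\<^sup>2) \<omega>
    \<le> (norm (X k \<omega> - xs))\<^sup>2
      - (1 - 2 * \<eta>) * (norm (f (X k \<omega>)))\<^sup>2 / (real CARD('m) * (frobenius_norm (J (X k \<omega>)))\<^sup>2)"
proof -
  let ?E = "real_cond_exp M (pskm_filtration M \<tau> \<iota> \<alpha> k)"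
  define h where "h i x = (1 - 2 * \<eta>) * (f x $ i)\<^sup>2 / (real \<beta> * (frobenius_norm (J x))\<^sup>2)" for i x
  let ?d = "\<lambda>\<omega>. (norm (X k \<omega> - xs))\<^sup>2"
  let ?s = "\<lambda>\<omega>. \<Sum>i\<in>UNIV. h i (X k \<omega>) * indicator (\<tau> (Suc k) \<omega>) i"
  have beta: "0 < real \<beta>" using sample_size(1) by simp
  have step: "AE \<omega> in M. (norm (X (Suc k) \<omega> - xs))\<^sup>2 \<le> ?d \<omega> - ?s \<omega>"
    using row_greedy[of k] AE_sample_card[of k]
  proof eventually_elim
    case (elim \<omega>)
    let ?x = "X k \<omega>" and ?i = "\<iota> (Suc k) \<omega>"
    have row: "0 < (norm (row ?i (J ?x)))\<^sup>2"
      using row_bounded_below_row_nonzero[OF rows[OF iterate_in_ball]] by simp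
    have "?s \<omega> = (1 - 2 * \<eta>) / (frobenius_norm (J ?x))\<^sup>2
        * ((\<Sum>j\<in>UNIV. (f ?x $ j)\<^sup>2 * indicator (\<tau> (Suc k) \<omega>) j) / real \<beta>)"
      unfolding h_def sum_distrib_left sum_divide_distrib
      by (rule sum.cong[OF refl]) (simp add: mult_ac)
    also have "\<dots> \<le> (1 - 2 * \<eta>) / (frobenius_norm (J ?x))\<^sup>2 * (f ?x $ ?i)\<^sup>2"
      using eta_bounds by (intro mult_left_mono greedy_residual_ge_average elim) simp
    also have "\<dots> = (1 - 2 * \<eta>) * (f ?x $ ?i)\<^sup>2 / (frobenius_norm (J ?x))\<^sup>2"
      by simp
    also have "\<dots> \<le> (1 - 2 * \<eta>) * (f ?x $ ?i)\<^sup>2 / (norm (row ?i (J ?x)))\<^sup>2"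
      using eta_bounds row row_norm_le_frobenius[of ?i "J ?x"]
      by (intro divide_left_mono mult_nonneg_nonneg mult_pos_pos) auto
    finally show ?case
      using step_descent[OF iterate_in_ball, of "\<alpha> (Suc k) \<omega>" ?i k \<omega>]
      unfolding iterate_Suc by linarith
  qed
  have d: "integrable M ?d"
    by (rule integrable_iterate)
  have s: "integrable M ?s"
    by (intro Bochner_Integration.integrable_sum integrable_sampled)
  have "AE \<omega> in M. ?E (\<lambda>\<omega>. (norm (X (Suc k) \<omega> - xs))\<^sup>2) \<omega> \<le> ?E (\<lambda>\<omega>. ?d \<omega> - ?s \<omega>) \<omega>"
    by (rule filtration.real_cond_exp_mono[OF step]) (use d s integrable_iterate in auto)
  moreover have "AE \<omega> in M. ?E (\<lambda>\<omega>. ?d \<omega> - ?s \<omega>) \<omega> = ?E ?d \<omega> - ?E ?s \<omega>"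
    by (rule filtration.real_cond_exp_diff[OF d s])
  moreover have "AE \<omega> in M. ?E ?d \<omega> = ?d \<omega>"
    by (rule filtration.real_cond_exp_F_meas[OF d measurable_iterate])
  moreover have "AE \<omega> in M. ?E ?s \<omega> = real \<beta> / real CARD('m) * (\<Sum>i\<in>UNIV. h i (X k \<omega>))"
    by (rule cond_exp_sampled_sum)
  ultimately show ?thesis
  proof eventually_elim
    case (elim \<omega>)
    have "(\<Sum>i\<in>UNIV. h i (X k \<omega>))
        = (1 - 2 * \<eta>) * (norm (f (X k \<omega>)))\<^sup>2 / (real \<beta> * (frobenius_norm (J (X k \<omega>)))\<^sup>2)"
      by (simp add: h_def norm_vec_def L2_set_def sum_nonneg sum_distrib_left sum_divide_distrib)
    then have "real \<beta> / real CARD('m) * (\<Sum>i\<in>UNIV. h i (X k \<omega>))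
        = (1 - 2 * \<eta>) * (norm (f (X k \<omega>)))\<^sup>2 / (real CARD('m) * (frobenius_norm (J (X k \<omega>)))\<^sup>2)"
      using beta by simp
    with elim show ?case by simp
  qed
qed

text \<open>
  The descent is passed from conditional to plain expectation for an arbitrary majorant \<open>g\<close>,
  because two are needed: the one with the varying rate and the one with the uniform rate.
\<close>

lemma mean_descent:
  assumes "\<And>x. x \<in> cball x\<^sub>0 \<rho> \<Longrightarrow> (norm (x - xs))\<^sup>2
      - (1 - 2 * \<eta>) * (norm (f x))\<^sup>2 / (real CARD('m) * (frobenius_norm (J x))\<^sup>2) \<le> g x"
  shows "AE \<omega> in M. real_cond_exp M (pskm_filtration M \<tau> \<iota> \<alpha> k)
      (\<lambda>\<omega>. (norm (X (Suc k) \<omega> - xs))\<^sup>2) \<omega> \<le> g (X k \<omega>)"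
    and "(\<integral>\<omega>. (norm (X (Suc k) \<omega> - xs))\<^sup>2 \<partial>M) \<le> (\<integral>\<omega>. g (X k \<omega>) \<partial>M)"
proof -
  show ae: "AE \<omega> in M. real_cond_exp M (pskm_filtration M \<tau> \<iota> \<alpha> k)
      (\<lambda>\<omega>. (norm (X (Suc k) \<omega> - xs))\<^sup>2) \<omega> \<le> g (X k \<omega>)"
    using cond_exp_descent[of k]
    by eventually_elim (rule order_trans[OF _ assms[OF iterate_in_ball]])
  have int: "integrable M (\<lambda>\<omega>. (norm (X (Suc k) \<omega> - xs))\<^sup>2)"
    by (rule integrable_iterate)
  have "(\<integral>\<omega>. (norm (X (Suc k) \<omega> - xs))\<^sup>2 \<partial>M) = (\<integral>\<omega>. real_cond_exp M (pskm_filtration M \<tau> \<iota> \<alpha> k)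
      (\<lambda>\<omega>. (norm (X (Suc k) \<omega> - xs))\<^sup>2) \<omega> \<partial>M)"
    using filtration.real_cond_exp_int(2)[OF int] by simp
  also have "\<dots> \<le> (\<integral>\<omega>. g (X k \<omega>) \<partial>M)"
    by (rule integral_mono_AE[OF filtration.real_cond_exp_int(1)[OF int] integrable_iterate ae])
  finally show "(\<integral>\<omega>. (norm (X (Suc k) \<omega> - xs))\<^sup>2 \<partial>M) \<le> (\<integral>\<omega>. g (X k \<omega>) \<partial>M)" .
qed

lemma descent_le_pskm_factor:
  assumes "x \<in> cball x\<^sub>0 \<rho>"
  shows "(norm (x - xs))\<^sup>2
      - (1 - 2 * \<eta>) * (norm (f x))\<^sup>2 / (real CARD('m) * (frobenius_norm (J x))\<^sup>2)
    \<le> pskm_factor \<eta> (J x) * (norm (x - xs))\<^sup>2"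
proof -
  let ?F = "real CARD('m) * (frobenius_norm (J x))\<^sup>2"
  have F: "0 < ?F"
    using row_bounded_below_frobenius_pos[OF rows[OF assms]] by simp
  have "(sigma_min (J x))\<^sup>2 * (norm (x - xs))\<^sup>2 \<le> (1 + \<eta>)\<^sup>2 * (norm (f x))\<^sup>2"
    using cone_singular_value_bound[OF cone assms solution_in_ball full_rank[OF assms]] solution(2)
    by simp
  then have "(sigma_min (J x))\<^sup>2 * (norm (x - xs))\<^sup>2 / (1 + \<eta>)\<^sup>2 \<le> (norm (f x))\<^sup>2"
    using eta_bounds by (simp add: divide_le_eq mult.commute)
  then have "(1 - 2 * \<eta>) / ?F * ((sigma_min (J x))\<^sup>2 * (norm (x - xs))\<^sup>2 / (1 + \<eta>)\<^sup>2)
      \<le> (1 - 2 * \<eta>) / ?F * (norm (f x))\<^sup>2"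
    using F eta_bounds by (intro mult_left_mono) auto
  then show ?thesis
    by (simp add: pskm_factor_def algebra_simps)
qed

text \<open>
  Convergence needs a contraction factor that is the same at all points of the ball.  Here the
  residual is bounded below with the Jacobian at the solution, whose smallest singular value is a
  constant; the Frobenius norm at \<open>x\<close>, which enters through the step length, is bounded on the ball.
\<close>

lemma uniform_descent:
  assumes "continuous_on (cball x\<^sub>0 \<rho>) f"
  obtains q where "0 \<le> q" "q < 1"
    "\<And>x. x \<in> cball x\<^sub>0 \<rho> \<Longrightarrow> (norm (x - xs))\<^sup>2
        - (1 - 2 * \<eta>) * (norm (f x))\<^sup>2 / (real CARD('m) * (frobenius_norm (J x))\<^sup>2)
      \<le> q * (norm (x - xs))\<^sup>2"
proof -
  obtain B where B: "0 < B" "\<And>x. x \<in> cball x\<^sub>0 \<rho> \<Longrightarrow> (frobenius_norm (J x))\<^sup>2 \<le> B"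
    using cone_jacobian_bounded[OF cone radius assms] by blast
  define s where "s = sigma_min (J xs)"
  have s: "0 < s"
    unfolding s_def by (rule sigma_min_full_column_rank(1)[OF full_rank[OF solution_in_ball]])
  define c where "c = (1 - 2 * \<eta>) / (real CARD('m) * B) * (s\<^sup>2 / (1 + \<eta>)\<^sup>2)"
  have c: "0 < c"
    using s B(1) eta_bounds by (simp add: c_def)
  have "(norm (x - xs))\<^sup>2 - (1 - 2 * \<eta>) * (norm (f x))\<^sup>2 / (real CARD('m) * (frobenius_norm (J x))\<^sup>2)
      \<le> max 0 (1 - c) * (norm (x - xs))\<^sup>2" if x: "x \<in> cball x\<^sub>0 \<rho>" for x
  proof -
    have F: "0 < (frobenius_norm (J x))\<^sup>2"
      using row_bounded_below_frobenius_pos[OF rows[OF x]] .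
    have "s\<^sup>2 * (norm (x - xs))\<^sup>2 \<le> (1 + \<eta>)\<^sup>2 * (norm (f x))\<^sup>2"
      using cone_singular_value_bound[OF cone solution_in_ball x full_rank[OF solution_in_ball]]
        solution(2) by (simp add: s_def norm_minus_commute)
    then have "s\<^sup>2 / (1 + \<eta>)\<^sup>2 * (norm (x - xs))\<^sup>2 \<le> (norm (f x))\<^sup>2"
      using eta_bounds by (simp add: divide_le_eq mult.commute)
    then have "c * (norm (x - xs))\<^sup>2 \<le> (1 - 2 * \<eta>) / (real CARD('m) * B) * (norm (f x))\<^sup>2"
      unfolding c_def mult.assoc using eta_bounds B(1) by (intro mult_left_mono) auto
    also have "\<dots> = (1 - 2 * \<eta>) * (norm (f x))\<^sup>2 / (real CARD('m) * B)"
      by simp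
    also have "\<dots> \<le> (1 - 2 * \<eta>) * (norm (f x))\<^sup>2 / (real CARD('m) * (frobenius_norm (J x))\<^sup>2)"
      using eta_bounds F B(1) B(2)[OF x]
      by (intro divide_left_mono mult_left_mono mult_pos_pos) simp_all
    finally have "(norm (x - xs))\<^sup>2 - (1 - 2 * \<eta>) * (norm (f x))\<^sup>2 / (real CARD('m) * (frobenius_norm (J x))\<^sup>2)
        \<le> (1 - c) * (norm (x - xs))\<^sup>2"
      by (simp add: algebra_simps)
    also have "\<dots> \<le> max 0 (1 - c) * (norm (x - xs))\<^sup>2"
      by (intro mult_right_mono) auto
    finally show ?thesis .
  qed
  with c show thesis by (intro that[of "max 0 (1 - c)"]) auto
qed

lemma iterates_converge:
  assumes "continuous_on (cball x\<^sub>0 \<rho>) f"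
  shows "converges_in_expectation M X xs"
proof -
  obtain q where q: "0 \<le> q" "q < 1" "\<And>x. x \<in> cball x\<^sub>0 \<rho> \<Longrightarrow> (norm (x - xs))\<^sup>2
        - (1 - 2 * \<eta>) * (norm (f x))\<^sup>2 / (real CARD('m) * (frobenius_norm (J x))\<^sup>2)
      \<le> q * (norm (x - xs))\<^sup>2"
    using uniform_descent[OF assms] by blast
  let ?e = "\<lambda>k. \<integral>\<omega>. (norm (X k \<omega> - xs))\<^sup>2 \<partial>M"
  have step: "?e (Suc k) \<le> q * ?e k" for k
    using mean_descent(2)[OF q(3), of k] by simp
  have bound: "?e k \<le> ?e 0 * q ^ k" for k
  proof (induction k)
    case (Suc k)
    from step[of k] mult_left_mono[OF Suc q(1)] show ?case
      by (simp add: mult_ac)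
  qed simp
  have lim: "(\<lambda>k. ?e 0 * q ^ k) \<longlonglongrightarrow> 0"
    using q by (intro tendsto_mult_right_zero LIMSEQ_power_zero) auto
  have "?e \<longlonglongrightarrow> 0"
    by (rule tendsto_sandwich[OF _ _ tendsto_const lim]) (use bound in auto)
  then show ?thesis
    unfolding converges_in_expectation_def by (intro conjI allI integrable_iterate)
qed

end

section \<open>The convergence theorem\<close>

theorem theorem3:
  fixes f :: "real^'n \<Rightarrow> real^'m"
    and J :: "real^'n \<Rightarrow> real^'n^'m"
    and D :: "(real^'n) set"
    and C :: "'c::finite \<Rightarrow> (real^'n) set"
    and x\<^sub>0 :: "real^'n"
    and \<rho> \<eta> :: real
    and \<beta> :: nat
    and M :: "'w measure"
    and \<tau> :: "nat \<Rightarrow> 'w \<Rightarrow> 'm set"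
    and \<iota> :: "nat \<Rightarrow> 'w \<Rightarrow> 'm"
    and \<alpha> :: "nat \<Rightarrow> 'w \<Rightarrow> 'c"
    and X :: "nat \<Rightarrow> 'w \<Rightarrow> real^'n"
  assumes jacobian: "\<And>x. x \<in> D \<Longrightarrow> (f has_derivative (\<lambda>h. J x *v h)) (at x within D)"
    and constraints: "\<And>c. closed (C c)" "\<And>c. convex (C c)" "\<And>c. C c \<noteq> {}" "(\<Inter>c. C c) \<noteq> {}"
    and start: "x\<^sub>0 \<in> D"
    and ball: "0 < \<rho>" "cball x\<^sub>0 \<rho> \<subseteq> D"
    and cone: "local_tangential_cone f J (cball x\<^sub>0 \<rho>) \<eta>"
    and rows: "\<And>x. x \<in> D \<Longrightarrow> row_bounded_below (J x)"
    and full_column_rank: "\<And>x. x \<in> D \<Longrightarrow> rank (J x) = CARD('n)"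
    and solvable: "\<exists>x\<in>cball x\<^sub>0 (\<rho> / 2). f x = 0 \<and> x \<in> (\<Inter>c. C c)"
    and run: "pskm M f J C x\<^sub>0 \<beta> \<tau> \<iota> \<alpha> X"
  shows "\<exists>xs\<in>cball x\<^sub>0 (\<rho> / 2). f xs = 0 \<and> xs \<in> (\<Inter>c. C c) \<and>
    converges_in_expectation M X xs \<and>
    (\<forall>k\<ge>1.
      (AE \<omega> in M.
        real_cond_exp M (pskm_filtration M \<tau> \<iota> \<alpha> (k - 1)) (\<lambda>\<omega>. (norm (X k \<omega> - xs))\<^sup>2) \<omega>
          \<le> pskm_factor \<eta> (J (X (k - 1) \<omega>)) * (norm (X (k - 1) \<omega> - xs))\<^sup>2) \<and>
      (\<integral>\<omega>. (norm (X k \<omega> - xs))\<^sup>2 \<partial>M)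
        \<le> (\<integral>\<omega>. pskm_factor \<eta> (J (X (k - 1) \<omega>)) * (norm (X (k - 1) \<omega> - xs))\<^sup>2 \<partial>M))"
proof -
  obtain xs where xs: "xs \<in> cball x\<^sub>0 (\<rho> / 2)" "f xs = 0" "xs \<in> (\<Inter>c. C c)"
    using solvable by blast
  interpret pskm_solution M f J C x\<^sub>0 \<beta> \<tau> \<iota> \<alpha> X \<rho> \<eta> xs
  proof (intro pskm_solution.intro pskm_solution_axioms.intro run)
    show "row_bounded_below (J x)" "rank (J x) = CARD('n)" if "x \<in> cball x\<^sub>0 \<rho>" for x
      using rows full_column_rank ball(2) that by blast+
  qed (use constraints ball(1) cone xs in auto)
  have "continuous_on D f"
    by (rule has_derivative_continuous_on[OF jacobian])
  then have conv: "converges_in_expectation M X xs"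
    using iterates_converge continuous_on_subset ball(2) by blast
  show ?thesis
  proof (intro bexI[OF _ xs(1)] conjI xs(2,3) conv allI impI)
    fix k :: nat assume "1 \<le> k"
    then have k: "k = Suc (k - 1)" by simp
    show "AE \<omega> in M.
        real_cond_exp M (pskm_filtration M \<tau> \<iota> \<alpha> (k - 1)) (\<lambda>\<omega>. (norm (X k \<omega> - xs))\<^sup>2) \<omega>
          \<le> pskm_factor \<eta> (J (X (k - 1) \<omega>)) * (norm (X (k - 1) \<omega> - xs))\<^sup>2"
      using mean_descent(1)[OF descent_le_pskm_factor, of "k - 1"] k by simp
    show "(\<integral>\<omega>. (norm (X k \<omega> - xs))\<^sup>2 \<partial>M)
        \<le> (\<integral>\<omega>. pskm_factor \<eta> (J (X (k - 1) \<omega>)) * (norm (X (k - 1) \<omega> - xs))\<^sup>2 \<partial>M)"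
      using mean_descent(2)[OF descent_le_pskm_factor, of "k - 1"] k by simp
  qed
qed

end
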